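(* Let $Z$ be a real-valued random variable on a probability space $(\Omega,\mathcal{F},\mathbb{P})$, and let $p\in(0,1)$. Then the subquantile of $Z$ at level $p$, $\underline{\mathbb{S}}_{p}[Z]=\frac{1}{p}\int_0^p Q_Z(p')\,dp'$, satisfies $$\underline{\mathbb{S}}_{p}[Z]=\max_{\eta\in\mathbb{R}}\left\{\eta-\frac{1}{p}\,\mathbb{E}\big[(\eta-Z)_+\big]\right\}.$$
   Context: For a real-valued random variable $Z$, the cumulative distribution function is $F_Z(z)=\mathbb{P}(Z\le z)$ for $z\in\mathbb{R}$, and the quantile function $Q_Z:(0,1)\to\mathbb{R}$ is $Q_Z(u)=\min\{z\in\mathbb{R}: F_Z(z)\ge u\}$ (equivalently, the infimum of that set). For $p\in(0,1)$, the subquantile of $Z$ at level $p$ is $\underline{\mathbb{S}}_p[Z]=\frac{1}{p}\int_0^p Q_Z(p')\,dp'$. For a real number $t$, $(t)_+=\max(t,0)$. The integral defining $\underline{\mathbb{S}}_p[Z]$ is taken as an extended-real value in $[-\infty,\infty)$ and $\mathbb{E}[(\eta-Z)_+]$ as a value in $[0,\infty]$; both are always well defined in this sense. The symbol $\max$ means that the supremum over $\eta\in\mathbb{R}$ is attained. *)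

theory Defs
  imports "HOL-Probability.Probability"
begin

text \<open>The least element exists for every \<open>0 < u < 1\<close>; values at other levels are never used.\<close>

definition quantile :: "'a measure \<Rightarrow> ('a \<Rightarrow> real) \<Rightarrow> real \<Rightarrow> real" where
  "quantile M Z u = (LEAST z. u \<le> cdf (distr M borel Z) z)"

text \<open>Since \<open>ennreal\<close> truncates negative reals to \<open>0\<close>, the two terms are the integrals of the
  positive and the negative part. The result is meaningful only if one of them is finite. For a
  quantile function on \<open>(0, p)\<close> with \<open>p < 1\<close> the first one is, because the function is
  bounded above there by its value at \<open>p\<close>.\<close>

definition ereal_integral :: "'a measure \<Rightarrow> ('a \<Rightarrow> real) \<Rightarrow> ereal" where
  "ereal_integral M f =
     enn2ereal (\<integral>\<^sup>+x. ennreal (f x) \<partial>M) - enn2ereal (\<integral>\<^sup>+x. ennreal (- f x) \<partial>M)"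

definition subquantile :: "'a measure \<Rightarrow> ('a \<Rightarrow> real) \<Rightarrow> real \<Rightarrow> ereal" where
  "subquantile M Z p =
     ereal (1 / p) * ereal_integral (restrict_space lborel {0<..<p}) (quantile M Z)"

text \<open>The expectation is taken in \<open>[0, \<infinity>]\<close>, so the value is \<open>-\<infinity>\<close> when it diverges.\<close>

definition subquantile_objective :: "'a measure \<Rightarrow> ('a \<Rightarrow> real) \<Rightarrow> real \<Rightarrow> real \<Rightarrow> ereal" where
  "subquantile_objective M Z p \<eta> =
     ereal \<eta> - ereal (1 / p) * enn2ereal (\<integral>\<^sup>+\<omega>. ennreal (max (\<eta> - Z \<omega>) 0) \<partial>M)"

end

theory Submission
  imports Defs
begin

text \<open>The argument rests on the pointwise inequality \<open>\<eta> - (\<eta> - y)\<^sub>+ \<le> y\<close>, which is an equality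
  exactly when \<open>y \<le> \<eta>\<close>. Integrating it at \<open>y = Q u\<close> over \<open>0 < u < p\<close>, where \<open>Q\<close> is the quantile
  function, gives \<open>p * \<eta> - \<integral>\<^sub>0\<^sup>p (\<eta> - Q)\<^sub>+ \<le> \<integral>\<^sub>0\<^sup>p Q\<close>. Under the uniform distribution on \<open>(0, 1)\<close>,
  \<open>Q\<close> has the distribution of \<open>Z\<close>, so the expected shortfall of \<open>Z\<close> below \<open>\<eta>\<close> is the integral of
  \<open>(\<eta> - Q)\<^sub>+\<close> over all of \<open>(0, 1)\<close> (lemma \<open>nn_integral_quantile\<close>), which is at least the one over
  \<open>(0, p)\<close>. After division by \<open>p\<close>, the objective never exceeds the subquantile.

  Two losses occur here: one in the pointwise inequality and one from discarding the levels
  \<open>u \<ge> p\<close>. Both vanish at \<open>\<eta> = Q p\<close> because \<open>Q\<close> is monotone: to the left of \<open>p\<close> one has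
  \<open>Q u \<le> \<eta>\<close>, so the pointwise inequality is an equality, and to the right of \<open>p\<close> one has
  \<open>\<eta> \<le> Q u\<close>, so the shortfall there contributes nothing. The maximum is therefore attained at the
  \<open>p\<close>-quantile.

  The lower tail of \<open>Z\<close> may fail to be integrable. The pointwise inequality is therefore integrated
  in the form of an identity whose error term is \<open>(Q - \<eta>)\<^sub>+\<close> (lemma \<open>ereal_integral_shortfall\<close>),
  obtained from an identity between sums of nonnegative functions, whose integrals may be infinite.\<close>

section \<open>Extended-real integrals and the shortfall below a level\<close>

text \<open>Integrated form of \<open>f - \<eta> = (f - \<eta>)\<^sub>+ - (\<eta> - f)\<^sub>+\<close>: the left-hand side is split into positive
  and negative parts, and subtracted terms are moved across, so that only nonnegative functions
  are integrated.\<close>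

lemma nn_integral_shortfall_identity:
  fixes f :: "'a \<Rightarrow> real"
  assumes "finite_measure D" and [measurable]: "f \<in> borel_measurable D"
  shows "(\<integral>\<^sup>+x. ennreal (f x) \<partial>D) + ennreal (measure D (space D) * max (- \<eta>) 0)
      + (\<integral>\<^sup>+x. ennreal (max (\<eta> - f x) 0) \<partial>D)
    = (\<integral>\<^sup>+x. ennreal (- f x) \<partial>D) + ennreal (measure D (space D) * max \<eta> 0)
      + (\<integral>\<^sup>+x. ennreal (max (f x - \<eta>) 0) \<partial>D)"
proof -
  interpret finite_measure D by fact
  have const: "ennreal c * emeasure D (space D) = ennreal (measure D (space D) * max c 0)" for c
    by (simp add: emeasure_eq_measure ennreal_mult mult.commute)
  have "ennreal (f x) + ennreal (max (- \<eta>) 0) + ennreal (max (\<eta> - f x) 0)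
      = ennreal (- f x) + ennreal (max \<eta> 0) + ennreal (max (f x - \<eta>) 0)" for x
  proof -
    have "max (f x) 0 + max (- \<eta>) 0 + max (\<eta> - f x) 0
        = max (- f x) 0 + max \<eta> 0 + max (f x - \<eta>) 0"
      by linarith
    then have "ennreal (max (f x) 0 + max (- \<eta>) 0 + max (\<eta> - f x) 0)
        = ennreal (max (- f x) 0 + max \<eta> 0 + max (f x - \<eta>) 0)"
      by (rule arg_cong)
    then have "ennreal (max (f x) 0) + ennreal (max (- \<eta>) 0) + ennreal (max (\<eta> - f x) 0)
        = ennreal (max (- f x) 0) + ennreal (max \<eta> 0) + ennreal (max (f x - \<eta>) 0)"
      by (simp only: ennreal_plus max.cobounded2 add_nonneg_nonneg)
    then show ?thesis
      by (simp add: max.commute)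
  qed
  then have "(\<integral>\<^sup>+x. ennreal (f x) + ennreal (max (- \<eta>) 0) + ennreal (max (\<eta> - f x) 0) \<partial>D)
      = (\<integral>\<^sup>+x. ennreal (- f x) + ennreal (max \<eta> 0) + ennreal (max (f x - \<eta>) 0) \<partial>D)"
    by simp
  then show ?thesis
    by (simp add: nn_integral_add const)
qed

text \<open>This is the integral of \<open>f = \<eta> - (\<eta> - f)\<^sub>+ + (f - \<eta>)\<^sub>+\<close>. Since the measure and the integral of
  the positive part of \<open>f\<close> are finite, so is the integral of \<open>(f - \<eta>)\<^sub>+\<close>; hence only the shortfall
  can be infinite, and it is so exactly when the negative part of \<open>f\<close> is not integrable.\<close>

lemma ereal_integral_shortfall:
  fixes f :: "'a \<Rightarrow> real"
  assumes D: "finite_measure D" and f: "f \<in> borel_measurable D"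
    and fin: "(\<integral>\<^sup>+x. ennreal (f x) \<partial>D) < \<infinity>"
  shows "ereal_integral D f
    = ereal (measure D (space D) * \<eta>) - enn2ereal (\<integral>\<^sup>+x. ennreal (max (\<eta> - f x) 0) \<partial>D)
      + enn2ereal (\<integral>\<^sup>+x. ennreal (max (f x - \<eta>) 0) \<partial>D)"
proof -
  interpret finite_measure D by fact
  note [measurable] = f
  define A where "A = (\<integral>\<^sup>+x. ennreal (f x) \<partial>D)"
  define B where "B = (\<integral>\<^sup>+x. ennreal (- f x) \<partial>D)"
  define N where "N = (\<integral>\<^sup>+x. ennreal (max (\<eta> - f x) 0) \<partial>D)"
  define C where "C = (\<integral>\<^sup>+x. ennreal (max (f x - \<eta>) 0) \<partial>D)"
  define m where "m = measure D (space D)"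
  have m: "0 \<le> m" by (simp add: m_def)
  have id: "A + ennreal (m * max (- \<eta>) 0) + N = B + ennreal (m * max \<eta> 0) + C"
    unfolding A_def B_def N_def C_def m_def by (rule nn_integral_shortfall_identity[OF D f])
  obtain a where a: "A = ennreal a" "0 \<le> a"
    using fin unfolding A_def by (cases "\<integral>\<^sup>+x. ennreal (f x) \<partial>D") auto
  have "C \<le> (\<integral>\<^sup>+x. ennreal (f x) + ennreal \<bar>\<eta>\<bar> \<partial>D)"
    unfolding C_def
  proof (intro nn_integral_mono)
    fix x
    have "ennreal (max (f x - \<eta>) 0) \<le> ennreal (max 0 (f x) + \<bar>\<eta>\<bar>)"
      by (intro ennreal_leI) linarith
    then show "ennreal (max (f x - \<eta>) 0) \<le> ennreal (f x) + ennreal \<bar>\<eta>\<bar>"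
      by (simp add: ennreal_plus)
  qed
  also have "\<dots> = A + ennreal \<bar>\<eta>\<bar> * emeasure D (space D)"
    by (simp add: nn_integral_add A_def)
  also have "\<dots> < \<infinity>"
    using a by (simp add: ennreal_mult_less_top emeasure_eq_measure)
  finally obtain c where c: "C = ennreal c" "0 \<le> c"
    by (cases C) auto
  have "enn2ereal A - enn2ereal B = ereal (m * \<eta>) - enn2ereal N + enn2ereal C"
  proof (cases N)
    case (real n)
    have "B + ennreal (m * max \<eta> 0) + C < \<infinity>"
      using id[symmetric] a real by simp
    then obtain b where b: "B = ennreal b" "0 \<le> b"
      by (cases B) auto
    have "ennreal (a + m * max (- \<eta>) 0 + n) = ennreal (b + m * max \<eta> 0 + c)"
      using id a real b c m by (simp add: ennreal_plus)
    then have "a + m * max (- \<eta>) 0 + n = b + m * max \<eta> 0 + c"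
      using a real b c m by (subst (asm) ennreal_inj) simp_all
    moreover have "m * \<eta> = m * max \<eta> 0 - m * max (- \<eta>) 0"
      by (simp add: max_def)
    ultimately have "a - b = m * \<eta> - n + c"
      by linarith
    then show ?thesis
      using a real b c by (simp add: enn2ereal_ennreal)
  next
    case top
    then have "B = \<infinity>"
      using id[symmetric] c by (simp add: ennreal_add_eq_top)
    then show ?thesis
      using a c top by (simp add: enn2ereal_ennreal)
  qed
  then show ?thesis
    unfolding ereal_integral_def A_def B_def N_def C_def m_def .
qed

section \<open>The quantile transform\<close>

text \<open>The least element in the definition of the quantile exists because the distribution function is
  monotone and right-continuous with limits \<open>0\<close> and \<open>1\<close>. The resulting Galois connection determines
  everything used about quantiles below.\<close>

lemma
  assumes "prob_space M" and "Z \<in> borel_measurable M" and "0 < u" and "u < 1"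
  shows quantile_le_iff: "quantile M Z u \<le> z \<longleftrightarrow> u \<le> cdf (distr M borel Z) z"
    and quantile_eq_Inf: "quantile M Z u = Inf {z. u \<le> cdf (distr M borel Z) z}"
proof -
  interpret prob_space M by fact
  interpret L: cdf_distribution "distr M borel Z"
    using assms(2) by (simp add: cdf_distribution_def)
  \<comment> \<open>Naming the infimum keeps the equivalence from rewriting inside its own right-hand side.\<close>
  define I where "I = Inf {z. u \<le> cdf (distr M borel Z) z}"
  have galois: "u \<le> cdf (distr M borel Z) z \<longleftrightarrow> I \<le> z" for z
    unfolding I_def by (rule L.pseudoinverse[OF assms(3,4)])
  have "quantile M Z u = I"
    unfolding quantile_def galois by (intro Least_equality) auto
  then show "quantile M Z u \<le> z \<longleftrightarrow> u \<le> cdf (distr M borel Z) z"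
    by (simp only: galois)
  show "quantile M Z u = Inf {z. u \<le> cdf (distr M borel Z) z}"
    using \<open>quantile M Z u = I\<close> unfolding I_def .
qed

lemma quantile_mono:
  assumes "prob_space M" and "Z \<in> borel_measurable M" and "0 < u" and "u \<le> v" and "v < 1"
  shows "quantile M Z u \<le> quantile M Z v"
proof -
  have "v \<le> cdf (distr M borel Z) (quantile M Z v)"
    using assms quantile_le_iff[OF assms(1,2), of v "quantile M Z v"] by simp
  then show ?thesis
    using assms quantile_le_iff[OF assms(1,2), of u "quantile M Z v"] by simp
qed

lemma quantile_measurable:
  assumes "prob_space M" and "Z \<in> borel_measurable M" and "p \<le> 1"
  shows "quantile M Z \<in> borel_measurable (restrict_space lborel {0<..<p})"
proof -
  have "mono_on {0<..<p} (quantile M Z)"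
    using assms by (auto intro!: mono_onI quantile_mono)
  then have "quantile M Z \<in> borel_measurable (restrict_space borel {0<..<p})"
    by (rule borel_measurable_mono_on_fnc)
  then show ?thesis
    by (simp add: measurable_def space_restrict_space sets_restrict_space)
qed

text \<open>The uniform distribution on \<open>(0, 1)\<close> gives \<open>{u. Q u \<le> z} = {u. u \<le> F z}\<close> the mass \<open>F z\<close>, so the
  quantile function \<open>Q\<close> transports it to the distribution with distribution function \<open>F\<close>.\<close>

lemma nn_integral_quantile:
  assumes "prob_space M" and Z: "Z \<in> borel_measurable M" and g: "g \<in> borel_measurable borel"
  shows "(\<integral>\<^sup>+u. g (quantile M Z u) \<partial>restrict_space lborel {0<..<1}) = (\<integral>\<^sup>+\<omega>. g (Z \<omega>) \<partial>M)"
proof -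
  interpret prob_space M by fact
  interpret L: cdf_distribution "distr M borel Z"
    using Z by (simp add: cdf_distribution_def)
  let ?U = "restrict_space lborel {0<..<1::real}"
  have "distr ?U borel (quantile M Z) = distr ?U borel L.I"
    using quantile_eq_Inf[OF assms(1,2)]
    by (intro distr_cong) (auto simp: space_restrict_space)
  then have law: "distr ?U borel (quantile M Z) = distr M borel Z"
    by (simp add: L.distr_I_eq_M)
  have "(\<integral>\<^sup>+u. g (quantile M Z u) \<partial>?U) = (\<integral>\<^sup>+z. g z \<partial>distr ?U borel (quantile M Z))"
    using quantile_measurable[OF assms(1,2)] g by (simp add: nn_integral_distr)
  also have "\<dots> = (\<integral>\<^sup>+\<omega>. g (Z \<omega>) \<partial>M)"
    unfolding law using Z g by (simp add: nn_integral_distr)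
  finally show ?thesis .
qed

lemma nn_integral_quantile_below_le:
  assumes "prob_space M" and "Z \<in> borel_measurable M" and "p \<le> 1"
    and "g \<in> borel_measurable borel"
  shows "(\<integral>\<^sup>+u. g (quantile M Z u) \<partial>restrict_space lborel {0<..<p}) \<le> (\<integral>\<^sup>+\<omega>. g (Z \<omega>) \<partial>M)"
  unfolding nn_integral_quantile[OF assms(1,2,4), symmetric] using assms(3)
  by (auto simp: nn_integral_restrict_space indicator_def intro!: nn_integral_mono)

text \<open>At levels \<open>u \<ge> p\<close> the quantile is at least \<open>quantile M Z p\<close>, so no shortfall occurs there.\<close>

lemma nn_integral_shortfall_at_quantile:
  assumes "prob_space M" and "Z \<in> borel_measurable M" and "0 < p" and "p < 1"
  defines "q \<equiv> quantile M Z p"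
  shows "(\<integral>\<^sup>+u. ennreal (max (q - quantile M Z u) 0) \<partial>restrict_space lborel {0<..<p})
    = (\<integral>\<^sup>+\<omega>. ennreal (max (q - Z \<omega>) 0) \<partial>M)"
proof -
  have "ennreal (max (q - quantile M Z u) 0) * indicator {0<..<p} u
      = ennreal (max (q - quantile M Z u) 0) * indicator {0<..<1} u" for u
    using quantile_mono[OF assms(1,2), of p u] assms(3,4)
    by (auto simp: q_def indicator_def max_def)
  then have "(\<integral>\<^sup>+u. ennreal (max (q - quantile M Z u) 0) \<partial>restrict_space lborel {0<..<p})
      = (\<integral>\<^sup>+u. ennreal (max (q - quantile M Z u) 0) \<partial>restrict_space lborel {0<..<1})"
    by (simp add: nn_integral_restrict_space)
  also have "\<dots> = (\<integral>\<^sup>+\<omega>. ennreal (max (q - Z \<omega>) 0) \<partial>M)"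
    by (rule nn_integral_quantile[OF assms(1,2)]) measurable
  finally show ?thesis .
qed

section \<open>The variational formula\<close>

text \<open>Extended-real subtraction does not distribute freely, but here the minuend is finite; with the
  factor \<open>1 / p\<close> outside, the objective compares directly with an integral over \<open>(0, p)\<close>.\<close>

lemma subquantile_objective_eq_scaled:
  assumes "0 < p"
  shows "subquantile_objective M Z p \<eta>
    = ereal (1 / p) * (ereal (p * \<eta>) - enn2ereal (\<integral>\<^sup>+\<omega>. ennreal (max (\<eta> - Z \<omega>) 0) \<partial>M))"
  unfolding subquantile_objective_def using assms
  by (cases "\<integral>\<^sup>+\<omega>. ennreal (max (\<eta> - Z \<omega>) 0) \<partial>M")
     (simp_all add: enn2ereal_ennreal field_simps)

theorem theoremA2:
  fixes M :: "'a measure" and Z :: "'a \<Rightarrow> real" and p :: real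
  assumes "prob_space M"
    and "Z \<in> borel_measurable M"
    and "0 < p" and "p < 1"
  shows "subquantile M Z p = (SUP \<eta>. subquantile_objective M Z p \<eta>) \<and>
    (\<exists>\<eta>. subquantile_objective M Z p \<eta> = (SUP \<eta>'. subquantile_objective M Z p \<eta>'))"
proof -
  let ?D = "restrict_space lborel {0<..<p}"
  let ?Q = "quantile M Z"
  let ?N = "\<lambda>\<eta>. \<integral>\<^sup>+\<omega>. ennreal (max (\<eta> - Z \<omega>) 0) \<partial>M"
  define q where "q = ?Q p"
  have emeasure_D: "emeasure ?D (space ?D) = ennreal p"
    using assms by (simp add: space_restrict_space emeasure_restrict_space)
  then have mass: "measure ?D (space ?D) = p"
    using assms by (simp add: measure_def)
  have D: "finite_measure ?D"
    using emeasure_D by (intro finite_measureI) simp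
  have Q: "?Q \<in> borel_measurable ?D"
    using assms by (simp add: quantile_measurable)
  have Q_le: "?Q u \<le> q" if "u \<in> space ?D" for u
    using that assms by (auto simp: q_def space_restrict_space intro!: quantile_mono)

  have "(\<integral>\<^sup>+u. ennreal (?Q u) \<partial>?D) \<le> (\<integral>\<^sup>+u. ennreal q \<partial>?D)"
    using Q_le by (intro nn_integral_mono ennreal_leI)
  also have "\<dots> < \<infinity>"
    using emeasure_D by (simp add: ennreal_mult_less_top)
  finally have fin: "(\<integral>\<^sup>+u. ennreal (?Q u) \<partial>?D) < \<infinity>" .

  have upper: "subquantile_objective M Z p \<eta> \<le> subquantile M Z p" for \<eta>
  proof -
    have "(\<integral>\<^sup>+u. ennreal (max (\<eta> - ?Q u) 0) \<partial>?D) \<le> ?N \<eta>"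
      using assms by (intro nn_integral_quantile_below_le) simp_all
    then have "ereal (p * \<eta>) - enn2ereal (?N \<eta>)
        \<le> ereal (p * \<eta>) - enn2ereal (\<integral>\<^sup>+u. ennreal (max (\<eta> - ?Q u) 0) \<partial>?D)"
      by (intro ereal_minus_mono) (simp_all add: less_eq_ennreal.rep_eq)
    also have "\<dots> \<le> ereal_integral ?D ?Q"
      unfolding ereal_integral_shortfall[OF D Q fin, of \<eta>] mass
      using add_left_mono[OF enn2ereal_nonneg] by fastforce
    finally show ?thesis
      unfolding subquantile_objective_eq_scaled[OF assms(3)] subquantile_def
      using assms(3) by (intro ereal_mult_left_mono) simp_all
  qed
  have "(\<integral>\<^sup>+u. ennreal (max (?Q u - q) 0) \<partial>?D) = (\<integral>\<^sup>+u. 0 \<partial>?D)"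
    using Q_le by (intro nn_integral_cong) (simp add: max_def)
  then have attained: "subquantile_objective M Z p q = subquantile M Z p"
    unfolding subquantile_objective_eq_scaled[OF assms(3)] subquantile_def
      ereal_integral_shortfall[OF D Q fin, of q] mass
    using nn_integral_shortfall_at_quantile[OF assms] by (simp add: q_def zero_ennreal.rep_eq)
  have "subquantile M Z p = (SUP \<eta>. subquantile_objective M Z p \<eta>)"
    using SUP_upper[of q UNIV "subquantile_objective M Z p"] upper attained
    by (intro antisym SUP_least) simp_all
  with attained show ?thesis
    by auto
qed

end
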